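(* Let $\widetilde{\mathfrak{G}}$ be the central extension of the group $\mathfrak{D}(\mathbb{T})$ of circle diffeomorphisms with Lie algebra $\widetilde{\mathfrak{X}}(\mathbb{T})=\mathfrak{X}(\mathbb{T})\times\mathbb{R}$ whose commutator is given by the trivial 2-cocycle $c(u,v)=\int_{\mathbb{T}}u_xv\,dx$ (see context). Then the Euler-Arnold equation for the right-invariant metric on $\widetilde{\mathfrak{G}}$ generated by the $H^1$ inner product $$\langle (u\partial,a),(v\partial,b)\rangle_{H^1}=\int_{\mathbb{T}}(uv+u_xv_x)\,dx+ab$$ on $\widetilde{\mathfrak{X}}(\mathbb{T})$ gives the general Camassa-Holm equation $$u_t+\kappa u_x-u_{txx}+3uu_x-2u_xu_{xx}-uu_{xxx}=0$$ with an arbitrary constant $\kappa\in\mathbb{R}$ (the constant $\kappa$ being the time-independent $\mathbb{R}$-component of the momentum variable).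
   Context: $\mathbb{T}$ is the circle, $\mathfrak{D}(\mathbb{T})$ is the Fréchet Lie group of smooth orientation-preserving diffeomorphisms of $\mathbb{T}$, and $\mathfrak{X}(\mathbb{T})$ is its Lie algebra of smooth vector fields $u\partial=u(x)\,\partial_x$ on $\mathbb{T}$, with commutator (adjoint operator) $\mathrm{ad}_{u\partial}(v\partial)=[u\partial,v\partial]=(u_xv-uv_x)\partial$ (sign convention used here). The extended Lie algebra $\widetilde{\mathfrak{X}}(\mathbb{T})=\mathfrak{X}(\mathbb{T})\times\mathbb{R}$ has the commutator $$[(u\partial,a),(v\partial,b)]=\Big([u\partial,v\partial],\ \int_{\mathbb{T}}u_xv\,dx\Big).$$ A group $\widetilde{\mathfrak{G}}$ with this Lie algebra is a central extension of $\mathfrak{D}(\mathbb{T})$, topologically $\mathfrak{D}(\mathbb{T})\times\mathbb{R}$ or $\mathfrak{D}(\mathbb{T})\times\mathbb{T}$; the Euler-Arnold equation depends only on the Lie algebra and the inner product. The smooth dual is $\widetilde{\mathfrak{X}}^*(\mathbb{T})=\{(m,\kappa): m\in\mathcal{C}^\infty(\mathbb{T}),\ \kappa\in\mathbb{R}\}$ with pairing $\langle\!\langle (m,\kappa),(v\partial,b)\rangle\!\rangle=\int_{\mathbb{T}}mv\,dx+\kappa b$. For a Lie algebra $\mathfrak{g}$ with smooth dual $\mathfrak{g}^*$ and inner product $\langle\cdot,\cdot\rangle$, the inertia operator $A:\mathfrak{g}\to\mathfrak{g}^*$ is defined by $\langle\!\langle Au,v\rangle\!\rangle=\langle u,v\rangle$,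 the coadjoint operator by $\langle\!\langle \mathrm{ad}^*_vm,u\rangle\!\rangle=\langle\!\langle m,\mathrm{ad}_vu\rangle\!\rangle$, and the Euler-Arnold equation of the corresponding right-invariant metric is $m_t=-\mathrm{ad}^*_{A^{-1}m}m$ for the momentum variable $m=Au$. Solutions are smooth. *)

theory Defs
  imports "HOL-Analysis.Analysis"
begin

section \<open>Smooth functions on the circle\<close>

primrec C_k_on :: "nat \<Rightarrow> 'a::euclidean_space set \<Rightarrow> ('a \<Rightarrow> real) \<Rightarrow> bool" where
  "C_k_on 0 S f \<longleftrightarrow> continuous_on S f"
| "C_k_on (Suc k) S f \<longleftrightarrow> (\<forall>z\<in>S. f differentiable (at z)) \<and>
     (\<forall>i\<in>Basis. C_k_on k S (\<lambda>z. frechet_derivative f (at z) i))"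

text \<open>Only used for open \<open>S\<close>. For \<open>'a = real \<times> real\<close> this is joint smoothness in both variables.\<close>
definition smooth_on :: "'a::euclidean_space set \<Rightarrow> ('a \<Rightarrow> real) \<Rightarrow> bool" where
  "smooth_on S f \<longleftrightarrow> (\<forall>k. C_k_on k S f)"

text \<open>The circle is \<open>\<real> / L\<int>\<close>, of arbitrary length \<open>L > 0\<close>, so that every normalisation is covered.
  Functions on it are \<open>L\<close>-periodic functions on \<open>\<real>\<close>, and integrals over it are integrals over
  \<open>[0, L]\<close>. The vector field \<open>u \<partial>\<^sub>x\<close> is represented by its coefficient \<open>u\<close>.\<close>
definition smooth_circle :: "real \<Rightarrow> (real \<Rightarrow> real) set" where
  "smooth_circle L = {u. smooth_on UNIV u \<and> (\<forall>x. u (x + L) = u x)}"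

section \<open>Inertia and coadjoint operators\<close>

text \<open>Arguments: the Lie algebra \<open>G\<close>, its smooth dual \<open>D\<close>, the pairing \<open>P\<close> between \<open>D\<close> and
  \<open>G\<close>, and the inner product or the commutator. The pairings considered below are
  nondegenerate, so the described elements of \<open>D\<close> are unique.\<close>

definition inertia_op ::
  "'g set \<Rightarrow> 'd set \<Rightarrow> ('d \<Rightarrow> 'g \<Rightarrow> real) \<Rightarrow> ('g \<Rightarrow> 'g \<Rightarrow> real) \<Rightarrow> 'g \<Rightarrow> 'd" where
  "inertia_op G D P ip u = (THE m. m \<in> D \<and> (\<forall>v\<in>G. P m v = ip u v))"

definition coadjoint_op ::
  "'g set \<Rightarrow> 'd set \<Rightarrow> ('d \<Rightarrow> 'g \<Rightarrow> real) \<Rightarrow> ('g \<Rightarrow> 'g \<Rightarrow> 'g) \<Rightarrow> 'g \<Rightarrow> 'd \<Rightarrow> 'd" where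
  "coadjoint_op G D P br v m = (THE n. n \<in> D \<and> (\<forall>u\<in>G. P n u = P m (br v u)))"

section \<open>The extended Lie algebra of vector fields\<close>

type_synonym ext_field = "(real \<Rightarrow> real) \<times> real"

definition vf_bracket :: "(real \<Rightarrow> real) \<Rightarrow> (real \<Rightarrow> real) \<Rightarrow> real \<Rightarrow> real" where
  "vf_bracket u v = (\<lambda>x. deriv u x * v x - u x * deriv v x)"

definition cocycle :: "real \<Rightarrow> (real \<Rightarrow> real) \<Rightarrow> (real \<Rightarrow> real) \<Rightarrow> real" where
  "cocycle L u v = integral {0..L} (\<lambda>x. deriv u x * v x)"

text \<open>A 2-cocycle is trivial if it is the coboundary of a linear functional.\<close>
definition trivial_cocycle ::
  "real \<Rightarrow> ((real \<Rightarrow> real) \<Rightarrow> (real \<Rightarrow> real) \<Rightarrow> real) \<Rightarrow> bool" where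
  "trivial_cocycle L c \<longleftrightarrow> (\<exists>f :: (real \<Rightarrow> real) \<Rightarrow> real.
     (\<forall>u\<in>smooth_circle L. \<forall>v\<in>smooth_circle L. \<forall>r s.
        f (\<lambda>x. r * u x + s * v x) = r * f u + s * f v) \<and>
     (\<forall>u\<in>smooth_circle L. \<forall>v\<in>smooth_circle L. c u v = f (vf_bracket u v)))"

definition ext_algebra :: "real \<Rightarrow> ext_field set" where
  "ext_algebra L = smooth_circle L \<times> UNIV"

definition ext_bracket :: "real \<Rightarrow> ext_field \<Rightarrow> ext_field \<Rightarrow> ext_field" where
  "ext_bracket L U V = (vf_bracket (fst U) (fst V), cocycle L (fst U) (fst V))"

definition ext_dual :: "real \<Rightarrow> ext_field set" where
  "ext_dual L = smooth_circle L \<times> UNIV"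

definition ext_pairing :: "real \<Rightarrow> ext_field \<Rightarrow> ext_field \<Rightarrow> real" where
  "ext_pairing L M V = integral {0..L} (\<lambda>x. fst M x * fst V x) + snd M * snd V"

definition H1_inner :: "real \<Rightarrow> ext_field \<Rightarrow> ext_field \<Rightarrow> real" where
  "H1_inner L U V =
     integral {0..L} (\<lambda>x. fst U x * fst V x + deriv (fst U) x * deriv (fst V) x) + snd U * snd V"

definition H1_inertia :: "real \<Rightarrow> ext_field \<Rightarrow> ext_field" where
  "H1_inertia L = inertia_op (ext_algebra L) (ext_dual L) (ext_pairing L) (H1_inner L)"

definition ext_coadjoint :: "real \<Rightarrow> ext_field \<Rightarrow> ext_field \<Rightarrow> ext_field" where
  "ext_coadjoint L = coadjoint_op (ext_algebra L) (ext_dual L) (ext_pairing L) (ext_bracket L)"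

section \<open>The Euler-Arnold and Camassa-Holm equations\<close>

text \<open>\<open>m\<^sub>t = - ad\<^sup>*\<^bsub>A\<^sup>-\<^sup>1 m\<^esub> m\<close> for a curve \<open>M\<close> in the dual, over the open time interval \<open>J\<close>;
  the time derivative is taken pointwise in \<open>x\<close>.\<close>
definition euler_arnold :: "real \<Rightarrow> real set \<Rightarrow> (real \<Rightarrow> ext_field) \<Rightarrow> bool" where
  "euler_arnold L J M \<longleftrightarrow> (\<forall>t\<in>J.
     let R = ext_coadjoint L (inv_into (ext_algebra L) (H1_inertia L) (M t)) (M t) in
       (\<forall>x. ((\<lambda>s. fst (M s) x) has_real_derivative - fst R x) (at t)) \<and>
       ((\<lambda>s. snd (M s)) has_real_derivative - snd R) (at t))"

definition dt :: "(real \<Rightarrow> real \<Rightarrow> real) \<Rightarrow> real \<Rightarrow> real \<Rightarrow> real" where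
  "dt u = (\<lambda>t x. deriv (\<lambda>s. u s x) t)"

definition dx :: "(real \<Rightarrow> real \<Rightarrow> real) \<Rightarrow> real \<Rightarrow> real \<Rightarrow> real" where
  "dx u = (\<lambda>t x. deriv (u t) x)"

definition camassa_holm :: "real \<Rightarrow> real set \<Rightarrow> (real \<Rightarrow> real \<Rightarrow> real) \<Rightarrow> bool" where
  "camassa_holm \<kappa> J u \<longleftrightarrow> (\<forall>t\<in>J. \<forall>x.
     dt u t x + \<kappa> * dx u t x - dx (dx (dt u)) t x + 3 * u t x * dx u t x
       - 2 * dx u t x * dx (dx u) t x - u t x * dx (dx (dx u)) t x = 0)"

end

theory Submission
  imports Defs
begin

text \<open>Integrating by parts on the circle, the inertia operator is \<open>(u, a) \<mapsto> (u - u\<^sub>x\<^sub>x, a)\<close> and the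
  coadjoint operator is \<open>ad\<^sup>*\<^sub>v (m, \<kappa>) = (2 m v\<^sub>x + m\<^sub>x v + \<kappa> v\<^sub>x, 0)\<close>; both are well defined because the
  \<open>L\<^sup>2\<close> pairing is nondegenerate on smooth functions. Hence \<open>\<kappa>\<close> is conserved, and substituting
  \<open>m = u - u\<^sub>x\<^sub>x\<close> in \<open>m\<^sub>t = - (2 m u\<^sub>x + m\<^sub>x u + \<kappa> u\<^sub>x)\<close> gives the Camassa-Holm equation. The cocycle is
  the coboundary of \<open>w \<mapsto> 1/2 \<integral> w\<close>.\<close>

section \<open>Calculus of smooth functions\<close>

text \<open>Derivatives at a point of an open set see only nearby values, so agreement on
  \<open>S\<close> passes to each derivative in turn. Later proofs use this to replace the
  \<open>frechet_derivative\<close> of a compound function by its explicit formula.\<close>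

lemma C_k_on_cong:
  assumes "open S" "\<And>z. z \<in> S \<Longrightarrow> f z = g z" "C_k_on k S f"
  shows "C_k_on k S g"
  using assms(2,3)
proof (induction k arbitrary: f g)
  case 0
  then show ?case
    using continuous_on_cong[of S S f g] by simp
next
  case (Suc k)
  have fr: "frechet_derivative f (at z) = frechet_derivative g (at z)" if "z \<in> S" for z
    using frechet_derivative_transform_within_open[of f z S g] Suc.prems \<open>open S\<close> that by simp
  have "g differentiable (at z)" if "z \<in> S" for z
  proof -
    have "(f has_derivative frechet_derivative f (at z)) (at z)"
      using Suc.prems that by (simp flip: frechet_derivative_works)
    then have "(g has_derivative frechet_derivative f (at z)) (at z)"
      using has_derivative_transform_within_open \<open>open S\<close> that Suc.prems(1) by blast
    then show ?thesis
      by (auto simp: differentiable_def)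
  qed
  moreover have "C_k_on k S (\<lambda>z. frechet_derivative g (at z) i)" if "i \<in> Basis" for i
    by (rule Suc.IH[of "\<lambda>z. frechet_derivative f (at z) i"]) (use Suc.prems fr that in auto)
  ultimately show ?case
    by simp
qed

lemma C_k_on_SucD: "C_k_on (Suc k) S f \<Longrightarrow> C_k_on k S f"
proof (induction k arbitrary: f)
  case 0
  then show ?case
    by (auto intro!: continuous_at_imp_continuous_on differentiable_imp_continuous_within)
next
  case (Suc k)
  then show ?case
    by (metis C_k_on.simps(2))
qed

lemma C_k_on_const: "C_k_on k S (\<lambda>z. c)"
  by (induction k arbitrary: c) auto

lemma C_k_on_add:
  assumes "open S" "C_k_on k S f" "C_k_on k S g"
  shows "C_k_on k S (\<lambda>z. f z + g z)"
  using assms(2,3)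
proof (induction k arbitrary: f g)
  case 0
  then show ?case
    by (auto intro: continuous_intros)
next
  case (Suc k)
  have fr: "frechet_derivative (\<lambda>z. f z + g z) (at z) =
      (\<lambda>i. frechet_derivative f (at z) i + frechet_derivative g (at z) i)" if "z \<in> S" for z
    using Suc.prems that
    by (intro frechet_derivative_at[symmetric] has_derivative_add)
      (simp_all flip: frechet_derivative_works)
  have "C_k_on k S (\<lambda>z. frechet_derivative (\<lambda>z. f z + g z) (at z) i)" if "i \<in> Basis" for i
    by (rule C_k_on_cong[OF \<open>open S\<close> _ Suc.IH[of "\<lambda>z. frechet_derivative f (at z) i"
            "\<lambda>z. frechet_derivative g (at z) i"]]) (use Suc.prems fr that in auto)
  then show ?case
    using Suc.prems by (auto intro: differentiable_add)
qed

lemma C_k_on_mult: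
  assumes "open S" "C_k_on k S f" "C_k_on k S g"
  shows "C_k_on k S (\<lambda>z. f z * g z)"
  using assms(2,3)
proof (induction k arbitrary: f g)
  case 0
  then show ?case
    by (auto intro: continuous_intros)
next
  case (Suc k)
  have fr: "frechet_derivative (\<lambda>z. f z * g z) (at z) =
      (\<lambda>i. f z * frechet_derivative g (at z) i + frechet_derivative f (at z) i * g z)"
    if "z \<in> S" for z
    using Suc.prems that
    by (intro frechet_derivative_at[symmetric] has_derivative_mult)
      (simp_all flip: frechet_derivative_works)
  have "C_k_on k S (\<lambda>z. frechet_derivative (\<lambda>z. f z * g z) (at z) i)" if "i \<in> Basis" for i
  proof (rule C_k_on_cong[OF \<open>open S\<close>])
    \<comment> \<open>The product rule leaves one factor undifferentiated, so \<open>f\<close> and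
      \<open>g\<close> themselves must first be lowered from order \<open>Suc k\<close> to order
      \<open>k\<close>.\<close>
    show "C_k_on k S (\<lambda>z. f z * frechet_derivative g (at z) i + frechet_derivative f (at z) i * g z)"
      using Suc.prems that C_k_on_SucD[of k S f] C_k_on_SucD[of k S g]
      by (intro C_k_on_add \<open>open S\<close> Suc.IH) auto
  qed (use fr in auto)
  then show ?case
    using Suc.prems by (auto intro: differentiable_mult)
qed

section \<open>Closure rules for smoothness of all orders\<close>

lemma smooth_on_const: "smooth_on S (\<lambda>z. c)"
  by (simp add: smooth_on_def C_k_on_const)

lemma smooth_on_add:
  "open S \<Longrightarrow> smooth_on S f \<Longrightarrow> smooth_on S g \<Longrightarrow> smooth_on S (\<lambda>z. f z + g z)"
  by (simp add: smooth_on_def C_k_on_add)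

lemma smooth_on_mult:
  "open S \<Longrightarrow> smooth_on S f \<Longrightarrow> smooth_on S g \<Longrightarrow> smooth_on S (\<lambda>z. f z * g z)"
  by (simp add: smooth_on_def C_k_on_mult)

lemma smooth_on_cong:
  "open S \<Longrightarrow> (\<And>z. z \<in> S \<Longrightarrow> f z = g z) \<Longrightarrow> smooth_on S f \<Longrightarrow> smooth_on S g"
  unfolding smooth_on_def using C_k_on_cong by blast

lemma smooth_on_imp_continuous_on: "smooth_on S f \<Longrightarrow> continuous_on S f"
  unfolding smooth_on_def by (metis C_k_on.simps(1))

lemma smooth_on_imp_has_derivative:
  "smooth_on S f \<Longrightarrow> z \<in> S \<Longrightarrow> (f has_derivative frechet_derivative f (at z)) (at z)"
  unfolding smooth_on_def by (metis C_k_on.simps(2) frechet_derivative_works)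

lemma smooth_on_frechet_derivative:
  "smooth_on S f \<Longrightarrow> i \<in> Basis \<Longrightarrow> smooth_on S (\<lambda>z. frechet_derivative f (at z) i)"
  unfolding smooth_on_def by (metis C_k_on.simps(2))

text \<open>A linear map on the line is multiplication by its value at 1. This links the Frechet
  derivatives in \<open>C_k_on\<close> with \<open>deriv\<close>.\<close>

lemma has_derivative_imp_has_real_derivative:
  fixes f :: "real \<Rightarrow> real"
  assumes "(f has_derivative F) (at x)"
  shows "(f has_real_derivative F 1) (at x)"
proof -
  have "F = (*) (F 1)"
  proof
    fix h
    show "F h = F 1 * h"
      using linear_scale[OF has_derivative_linear[OF assms], of h 1]
      by (metis mult.commute mult.right_neutral real_scaleR_def)
  qed
  with assms show ?thesis
    unfolding has_field_derivative_def by (metis (no_types))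
qed

lemma smooth_on_has_real_derivative:
  fixes f :: "real \<Rightarrow> real"
  assumes "smooth_on S f" "x \<in> S"
  shows "(f has_real_derivative deriv f x) (at x)"
  using has_derivative_imp_has_real_derivative[OF smooth_on_imp_has_derivative[OF assms]]
  by (metis DERIV_imp_deriv)

lemma smooth_on_deriv:
  fixes f :: "real \<Rightarrow> real"
  assumes "open S" "smooth_on S f"
  shows "smooth_on S (deriv f)"
proof (rule smooth_on_cong[OF assms(1)])
  show "smooth_on S (\<lambda>z. frechet_derivative f (at z) 1)"
    using smooth_on_frechet_derivative[OF assms(2)] by simp
  show "frechet_derivative f (at z) 1 = deriv f z" if "z \<in> S" for z
    using has_derivative_imp_has_real_derivative[OF smooth_on_imp_has_derivative[OF assms(2) that]]
    by (metis DERIV_imp_deriv)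
qed

section \<open>Time-dependent smooth functions\<close>

text \<open>Chain rule along the lines \<open>s \<mapsto> (s, x)\<close> and
  \<open>y \<mapsto> (t, y)\<close>, whose directions are the two basis vectors.\<close>

lemma partial_derivatives:
  assumes "smooth_on (J \<times> UNIV) (\<lambda>(t, x). u t x)" "t \<in> J"
  shows "((\<lambda>s. u s x) has_real_derivative frechet_derivative (\<lambda>(t, x). u t x) (at (t, x)) (1, 0)) (at t)"
    and "(u t has_real_derivative frechet_derivative (\<lambda>(t, x). u t x) (at (t, x)) (0, 1)) (at x)"
proof -
  have D: "((\<lambda>(t, x). u t x) has_derivative frechet_derivative (\<lambda>(t, x). u t x) (at (t, x))) (at (t, x))"
    using smooth_on_imp_has_derivative[OF assms(1)] assms(2) by auto
  have "((\<lambda>s. (s, x)) has_derivative (\<lambda>h. (h, 0))) (at t)"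
    by (intro has_derivative_Pair has_derivative_ident has_derivative_const)
  from has_derivative_imp_has_real_derivative[OF has_derivative_compose[OF this D]]
  show "((\<lambda>s. u s x) has_real_derivative frechet_derivative (\<lambda>(t, x). u t x) (at (t, x)) (1, 0)) (at t)"
    by simp
  have "((\<lambda>y. (t, y)) has_derivative (\<lambda>h. (0, h))) (at x)"
    by (intro has_derivative_Pair has_derivative_ident has_derivative_const)
  from has_derivative_imp_has_real_derivative[OF has_derivative_compose[OF this D]]
  show "(u t has_real_derivative frechet_derivative (\<lambda>(t, x). u t x) (at (t, x)) (0, 1)) (at x)"
    by simp
qed

lemma has_real_derivative_dt:
  assumes "smooth_on (J \<times> UNIV) (\<lambda>(t, x). u t x)" "t \<in> J"
  shows "((\<lambda>s. u s x) has_real_derivative dt u t x) (at t)"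
  using partial_derivatives(1)[OF assms, of x] DERIV_imp_deriv[OF partial_derivatives(1)[OF assms, of x]]
  by (simp add: dt_def)

lemma has_real_derivative_dx:
  assumes "smooth_on (J \<times> UNIV) (\<lambda>(t, x). u t x)" "t \<in> J"
  shows "(u t has_real_derivative dx u t x) (at x)"
  using partial_derivatives(2)[OF assms, of x] DERIV_imp_deriv[OF partial_derivatives(2)[OF assms, of x]]
  by (simp add: dx_def)

text \<open>Components of the Frechet derivative of a smooth function are smooth straight from
  \<open>C_k_on\<close>, and on the open set \<open>J \<times> UNIV\<close> the component along
  \<open>(1, 0)\<close> is \<open>dt u\<close>.\<close>

lemma smooth_on_dt:
  assumes "open J" "smooth_on (J \<times> UNIV) (\<lambda>(t, x). u t x)"
  shows "smooth_on (J \<times> UNIV) (\<lambda>(t, x). dt u t x)"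
proof (rule smooth_on_cong)
  show "smooth_on (J \<times> UNIV) (\<lambda>z. frechet_derivative (\<lambda>(t, x). u t x) (at z) (1, 0))"
    by (rule smooth_on_frechet_derivative[OF assms(2)]) (simp add: Basis_prod_def)
  show "frechet_derivative (\<lambda>(t, x). u t x) (at z) (1, 0) = (\<lambda>(t, x). dt u t x) z"
    if "z \<in> J \<times> UNIV" for z
    using that DERIV_imp_deriv[OF partial_derivatives(1)[OF assms(2), of "fst z" "snd z"]]
    by (auto simp: dt_def)
qed (simp add: assms(1) open_Times)

lemma smooth_on_dx:
  assumes "open J" "smooth_on (J \<times> UNIV) (\<lambda>(t, x). u t x)"
  shows "smooth_on (J \<times> UNIV) (\<lambda>(t, x). dx u t x)"
proof (rule smooth_on_cong)
  show "smooth_on (J \<times> UNIV) (\<lambda>z. frechet_derivative (\<lambda>(t, x). u t x) (at z) (0, 1))"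
    by (rule smooth_on_frechet_derivative[OF assms(2)]) (simp add: Basis_prod_def)
  show "frechet_derivative (\<lambda>(t, x). u t x) (at z) (0, 1) = (\<lambda>(t, x). dx u t x) z"
    if "z \<in> J \<times> UNIV" for z
    using that DERIV_imp_deriv[OF partial_derivatives(2)[OF assms(2), of "fst z" "snd z"]]
    by (auto simp: dx_def)
qed (simp add: assms(1) open_Times)

lemma smooth_on_slice:
  fixes u :: "real \<Rightarrow> real \<Rightarrow> real"
  assumes "open J" "smooth_on (J \<times> UNIV) (\<lambda>(t, x). u t x)" "t \<in> J"
  shows "smooth_on UNIV (u t)"
proof -
  \<comment> \<open>The induction varies \<open>u\<close>: the derivative of a slice of
    \<open>u\<close> is the slice of \<open>dx u\<close>, which is again jointly smooth.\<close>
  have "C_k_on k UNIV (u t)" if "smooth_on (J \<times> UNIV) (\<lambda>(t, x). u t x)" for k and u :: "real \<Rightarrow> real \<Rightarrow> real"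
    using that
  proof (induction k arbitrary: u)
    case 0
    have "isCont (u t) x" for x
      using has_real_derivative_dx[OF 0 assms(3)] DERIV_isCont by blast
    then show ?case
      by (simp add: continuous_at_imp_continuous_on)
  next
    case (Suc k)
    have D: "(u t has_real_derivative dx u t x) (at x)" for x
      by (rule has_real_derivative_dx[OF Suc.prems assms(3)])
    then have "frechet_derivative (u t) (at x) 1 = dx u t x" for x
      using frechet_derivative_at[OF D[unfolded has_field_derivative_def], of x, symmetric]
      by simp
    moreover have "u t differentiable (at x)" for x
      using D by (auto simp: differentiable_def has_field_derivative_def)
    ultimately show ?case
      using Suc.IH[OF smooth_on_dx[OF assms(1) Suc.prems]] by simp
  qed
  with assms(2) show ?thesis
    by (simp add: smooth_on_def)
qed

text \<open>Schwarz's theorem by contradiction. If the two values differed, continuity would keep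
  each mixed derivative within half of the gap near \<open>(t, x)\<close>, so the two could not
  share a value at nearby points.\<close>

lemma dt_dx_commute:
  assumes "open J" "smooth_on (J \<times> UNIV) (\<lambda>(t, x). u t x)" "t \<in> J"
  shows "dt (dx u) t x = dx (dt u) t x"
proof (rule ccontr)
  define A where "A = dt (dx u) t x"
  define B where "B = dx (dt u) t x"
  define e where "e = \<bar>A - B\<bar> / 2"
  assume "dt (dx u) t x \<noteq> dx (dt u) t x"
  then have "e > 0"
    by (simp add: e_def A_def B_def)
  note sx = smooth_on_dx[OF assms(1,2)] and st = smooth_on_dt[OF assms(1,2)]
  have op: "open (J \<times> (UNIV :: real set))"
    by (simp add: assms(1) open_Times)
  have "isCont (\<lambda>(t, x). dt (dx u) t x) (t, x)" "isCont (\<lambda>(t, x). dx (dt u) t x) (t, x)"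
    using smooth_on_imp_continuous_on[OF smooth_on_dt[OF assms(1) sx]]
      smooth_on_imp_continuous_on[OF smooth_on_dx[OF assms(1) st]] op assms(3)
    by (auto simp: continuous_on_eq_continuous_at)
  then obtain d1 d2 where d: "d1 > 0" "d2 > 0"
    and d1: "\<And>z. dist z (t, x) < d1 \<Longrightarrow> dist ((\<lambda>(t, x). dt (dx u) t x) z) A < e"
    and d2: "\<And>z. dist z (t, x) < d2 \<Longrightarrow> dist ((\<lambda>(t, x). dx (dt u) t x) z) B < e"
    unfolding continuous_at_eps_delta A_def B_def using \<open>e > 0\<close> by (metis (no_types, lifting) case_prod_conv)
  obtain d3 where d3: "d3 > 0" "\<And>s. dist s t < d3 \<Longrightarrow> s \<in> J"
    using assms(1,3) unfolding open_dist by blast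
  text \<open>The mixed second difference \<open>Q\<close> of \<open>u\<close> over a small square equals \<open>h\<^sup>2\<close> times a value of
    either mixed derivative nearby, by two applications of the mean value theorem.\<close>
  define h where "h = min (min d1 d2) d3 / 2"
  have h: "h > 0" "2 * h \<le> d1" "2 * h \<le> d2" "h < d3"
    using d d3(1) by (auto simp: h_def)
  \<comment> \<open>The distance is bounded by the sum of the coordinate differences, each below
    \<open>h\<close>; hence the factor 2 and the halving in \<open>h\<close>.\<close>
  have near: "dist (s, y) (t, x) < 2 * h" if "t < s" "s < t + h" "x < y" "y < x + h" for s y
  proof -
    have "dist (s, y) (t, x) \<le> \<bar>s - t\<bar> + \<bar>y - x\<bar>"
      unfolding dist_Pair_Pair dist_real_def using sqrt_sum_squares_le_sum_abs by simp
    with that show ?thesis by simp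
  qed
  have inJ: "s \<in> J" if "t \<le> s" "s \<le> t + h" for s
    using that d3(2)[of s] h by (auto simp: dist_real_def)
  define Q where "Q = u (t + h) (x + h) - u (t + h) x - u t (x + h) + u t x"
  have "\<exists>s>t. s < t + h \<and> (u (t + h) (x + h) - u (t + h) x) - (u t (x + h) - u t x) =
      (t + h - t) * (dt u s (x + h) - dt u s x)"
    using h(1) by (intro MVT2 DERIV_diff has_real_derivative_dt[OF assms(2)] inJ) auto
  then obtain s where s: "t < s" "s < t + h" "Q = h * (dt u s (x + h) - dt u s x)"
    by (auto simp: Q_def algebra_simps)
  have "\<exists>y>x. y < x + h \<and> dt u s (x + h) - dt u s x = (x + h - x) * dx (dt u) s y"
    using h(1) s by (intro MVT2 has_real_derivative_dx[OF st] inJ) auto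
  then obtain y where y: "x < y" "y < x + h" "Q = h * (h * dx (dt u) s y)"
    using s by auto
  \<comment> \<open>The same \<open>Q\<close>, regrouped so that the mean value theorem is applied
    in space first and in time second.\<close>
  have "\<exists>y>x. y < x + h \<and> (u (t + h) (x + h) - u t (x + h)) - (u (t + h) x - u t x) =
      (x + h - x) * (dx u (t + h) y - dx u t y)"
    using h(1) by (intro MVT2 DERIV_diff has_real_derivative_dx[OF assms(2)] inJ) auto
  then obtain y' where y': "x < y'" "y' < x + h" "Q = h * (dx u (t + h) y' - dx u t y')"
    by (auto simp: Q_def algebra_simps)
  have "\<exists>s>t. s < t + h \<and> dx u (t + h) y' - dx u t y' = (t + h - t) * dt (dx u) s y'"
    using h(1) by (intro MVT2 has_real_derivative_dt[OF sx] inJ) auto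
  then obtain s' where s': "t < s'" "s' < t + h" "Q = h * (h * dt (dx u) s' y')"
    using y' by auto
  have "dt (dx u) s' y' = dx (dt u) s y"
    using y(3) s'(3) h(1) by simp
  moreover have "\<bar>dt (dx u) s' y' - A\<bar> < e"
    using d1[of "(s', y')"] near[of s' y'] s' y' h by (simp add: dist_real_def)
  moreover have "\<bar>dx (dt u) s y - B\<bar> < e"
    using d2[of "(s, y)"] near[of s y] s y h by (simp add: dist_real_def)
  ultimately show False
    unfolding e_def by (simp add: abs_if field_simps split: if_splits)
qed

section \<open>Smooth functions on the circle\<close>

lemma smooth_circle_const: "(\<lambda>x. c) \<in> smooth_circle L"
  by (simp add: smooth_circle_def smooth_on_const)

lemma smooth_circle_add:
  "f \<in> smooth_circle L \<Longrightarrow> g \<in> smooth_circle L \<Longrightarrow> (\<lambda>x. f x + g x) \<in> smooth_circle L"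
  by (simp add: smooth_circle_def smooth_on_add)

lemma smooth_circle_mult:
  "f \<in> smooth_circle L \<Longrightarrow> g \<in> smooth_circle L \<Longrightarrow> (\<lambda>x. f x * g x) \<in> smooth_circle L"
  by (simp add: smooth_circle_def smooth_on_mult)

lemma smooth_circle_diff:
  assumes "f \<in> smooth_circle L" "g \<in> smooth_circle L"
  shows "(\<lambda>x. f x - g x) \<in> smooth_circle L"
  using smooth_circle_add[OF assms(1) smooth_circle_mult[OF smooth_circle_const[of "-1"] assms(2)]]
  by simp

text \<open>Periodicity survives because the shifted function is \<open>f\<close> itself and
  derivatives are unique.\<close>

lemma smooth_circle_deriv:
  assumes "f \<in> smooth_circle L"
  shows "deriv f \<in> smooth_circle L"
proof -
  have D: "(f has_real_derivative deriv f x) (at x)" for x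
    using assms smooth_on_has_real_derivative[of UNIV] by (simp add: smooth_circle_def)
  have "deriv f (x + L) = deriv f x" for x
  proof -
    have "((\<lambda>y. f (y + L)) has_real_derivative deriv f (x + L)) (at x)"
      using D[of "x + L"] by (simp add: DERIV_shift)
    moreover have "(\<lambda>y. f (y + L)) = f"
      using assms by (auto simp: smooth_circle_def)
    ultimately show ?thesis
      using D[of x] DERIV_unique by auto
  qed
  then show ?thesis
    using assms by (simp add: smooth_circle_def smooth_on_deriv)
qed

lemmas smooth_circle_intros =
  smooth_circle_const smooth_circle_add smooth_circle_mult smooth_circle_diff smooth_circle_deriv

lemma smooth_circle_has_real_derivative:
  "f \<in> smooth_circle L \<Longrightarrow> (f has_real_derivative deriv f x) (at x)"
  using smooth_on_has_real_derivative[of UNIV] by (simp add: smooth_circle_def)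

section \<open>Integration over one period\<close>

lemma smooth_circle_integrable:
  assumes "f \<in> smooth_circle L"
  shows "f integrable_on {0..L}"
proof -
  have "continuous_on UNIV f"
    using assms by (simp add: smooth_circle_def smooth_on_imp_continuous_on)
  then show ?thesis
    by (meson integrable_continuous_interval continuous_on_subset subset_UNIV)
qed

text \<open>The boundary terms \<open>f L\<close> and \<open>f 0\<close> cancel by periodicity.
  Every integration by parts below is an instance: it suffices to exhibit the difference of two
  integrands as the derivative of a periodic \<open>f\<close>.\<close>

lemma smooth_circle_integral_eqI:
  assumes "L > 0" "f \<in> smooth_circle L" "F \<in> smooth_circle L" "G \<in> smooth_circle L"
    and "\<And>x. (f has_real_derivative F x - G x) (at x)"
  shows "integral {0..L} F = integral {0..L} G"
proof -
  have "((\<lambda>x. F x - G x) has_integral f L - f 0) {0..L}"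
    using assms
    by (intro fundamental_theorem_of_calculus)
      (auto simp flip: has_real_derivative_iff_has_vector_derivative
        intro: has_field_derivative_at_within)
  moreover have "f L = f 0"
    using assms(2) by (simp add: smooth_circle_def) (metis add_0)
  ultimately have "integral {0..L} (\<lambda>x. F x - G x) = 0"
    by (simp add: integral_unique)
  then show ?thesis
    using assms(3,4) by (simp add: integral_diff smooth_circle_integrable)
qed

text \<open>A continuous nonnegative function with zero integral vanishes on the period
  \<open>{0..L}\<close>, and periodicity carries this to the whole line.\<close>

lemma smooth_circle_integral_eq_0D:
  assumes "L > 0" "f \<in> smooth_circle L" "\<And>x. f x \<ge> 0" "integral {0..L} f = 0"
  shows "f x = 0"
proof -
  have per: "f (y + L) = f y" for y
    using assms(2) by (simp add: smooth_circle_def)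
  have pern: "f (y + real n * L) = f y" for y n
  proof (induction n)
    case (Suc n)
    then show ?case
      using per[of "y + real n * L"] by (simp add: algebra_simps)
  qed simp
  \<comment> \<open>For negative \<open>k\<close>, the natural-number case is applied from the point
    \<open>y + of_int k * L\<close> forwards.\<close>
  have peri: "f (y + of_int k * L) = f y" for y k
    using pern[of y "nat k"] pern[of "y + of_int k * L" "nat (- k)"]
    by (cases "k \<ge> 0") (auto simp: algebra_simps)
  have "continuous_on UNIV f"
    using assms(2) by (simp add: smooth_circle_def smooth_on_imp_continuous_on)
  then have "continuous_on {0..L} f"
    using continuous_on_subset by blast
  then have z: "f y = 0" if "y \<in> {0..L}" for y
    using integral_eq_0_iff[of 0 L f] assms that by auto
  have "x + of_int (- \<lfloor>x / L\<rfloor>) * L \<in> {0..L}"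
    using floor_divide_lower[OF assms(1), of x] floor_divide_upper[OF assms(1), of x]
    by (simp add: algebra_simps)
  then show ?thesis
    using z peri[of x "- \<lfloor>x / L\<rfloor>"] by simp
qed

text \<open>Testing with the difference \<open>w\<close> of the function parts makes the integral of
  its square vanish; testing with \<open>(0, 1)\<close> isolates the real parts. This provides the
  uniqueness behind both \<open>THE\<close> operators.\<close>

lemma ext_pairing_nondegenerate:
  assumes "L > 0" "M \<in> ext_dual L" "N \<in> ext_dual L"
    and eq: "\<And>V. V \<in> ext_algebra L \<Longrightarrow> ext_pairing L M V = ext_pairing L N V"
  shows "M = N"
proof -
  obtain m a n b where MN: "M = (m, a)" "N = (n, b)"
    by (metis surj_pair)
  have mn: "m \<in> smooth_circle L" "n \<in> smooth_circle L"
    using assms(2,3) by (auto simp: MN ext_dual_def)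
  define w where "w = (\<lambda>x. m x - n x)"
  have w: "w \<in> smooth_circle L"
    unfolding w_def by (intro smooth_circle_intros mn)
  have "integral {0..L} (\<lambda>x. m x * w x) = integral {0..L} (\<lambda>x. n x * w x)"
    using eq[of "(w, 0)"] w by (simp add: MN ext_algebra_def ext_pairing_def)
  moreover have "(\<lambda>x. w x * w x) = (\<lambda>x. m x * w x - n x * w x)"
    by (auto simp: w_def algebra_simps)
  ultimately have int0: "integral {0..L} (\<lambda>x. w x * w x) = 0"
    using mn w by (simp add: integral_diff smooth_circle_integrable smooth_circle_mult)
  have "w x * w x = 0" for x
    by (rule smooth_circle_integral_eq_0D[OF assms(1) smooth_circle_mult[OF w w] _ int0]) simp
  then have "m = n"
    by (simp add: w_def fun_eq_iff)
  moreover have "a = b"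
    using eq[of "(\<lambda>x. 0, 1)"] by (simp add: MN ext_algebra_def ext_pairing_def smooth_circle_const)
  ultimately show ?thesis
    by (simp add: MN)
qed

section \<open>The inertia and coadjoint operators\<close>

text \<open>The second claim is the defining property of the operator, kept for the injectivity
  proof, where it gives back the inner product.\<close>

lemma H1_inertia_eq:
  assumes "L > 0" "u \<in> smooth_circle L"
  shows "H1_inertia L (u, a) = (\<lambda>x. u x - deriv (deriv u) x, a)"
    and "V \<in> ext_algebra L \<Longrightarrow> ext_pairing L (H1_inertia L (u, a)) V = H1_inner L (u, a) V"
proof -
  let ?M = "(\<lambda>x. u x - deriv (deriv u) x, a)"
  note u = assms(2)
  have M: "?M \<in> ext_dual L"
    by (simp add: ext_dual_def smooth_circle_intros u)
  have P: "ext_pairing L ?M V = H1_inner L (u, a) V" if V: "V \<in> ext_algebra L" for V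
  proof -
    obtain v b where Vv: "V = (v, b)" "v \<in> smooth_circle L"
      using V by (auto simp: ext_algebra_def)
    \<comment> \<open>The integrands differ by
      \<open>u\<^sub>x v\<^sub>x + u\<^sub>x\<^sub>x v\<close>, the derivative of
      \<open>u\<^sub>x v\<close>.\<close>
    have "integral {0..L} (\<lambda>x. u x * v x + deriv u x * deriv v x) =
        integral {0..L} (\<lambda>x. (u x - deriv (deriv u) x) * v x)"
      by (rule smooth_circle_integral_eqI[OF assms(1), of "\<lambda>x. deriv u x * v x"])
        (auto intro!: smooth_circle_intros u Vv derivative_eq_intros
          smooth_circle_has_real_derivative[of _ L] simp: algebra_simps)
    then show ?thesis
      by (simp add: Vv ext_pairing_def H1_inner_def)
  qed
  show eq: "H1_inertia L (u, a) = ?M"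
    unfolding H1_inertia_def inertia_op_def
  proof (rule the_equality)
    show "N = ?M"
      if "N \<in> ext_dual L \<and> (\<forall>V\<in>ext_algebra L. ext_pairing L N V = H1_inner L (u, a) V)" for N
      by (rule ext_pairing_nondegenerate[OF assms(1)]) (use that M P in auto)
  qed (use M P in blast)
  show "ext_pairing L (H1_inertia L (u, a)) V = H1_inner L (u, a) V" if "V \<in> ext_algebra L"
    using P[OF that] by (simp add: eq)
qed

text \<open>Positive definiteness: pairing equal images with the difference \<open>w\<close> of the
  fields gives a zero integral of \<open>w\<^sup>2 + w\<^sub>x\<^sup>2\<close>. Injectivity makes
  \<open>inv_into\<close> in \<open>euler_arnold\<close> recover the velocity.\<close>

lemma inj_on_H1_inertia:
  assumes "L > 0"
  shows "inj_on (H1_inertia L) (ext_algebra L)"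
proof (rule inj_onI)
  fix U V
  assume U: "U \<in> ext_algebra L" and V: "V \<in> ext_algebra L"
    and eq: "H1_inertia L U = H1_inertia L V"
  obtain u a v b where UV: "U = (u, a)" "V = (v, b)"
    by (metis surj_pair)
  have uv: "u \<in> smooth_circle L" "v \<in> smooth_circle L"
    using U V by (auto simp: UV ext_algebra_def)
  define w where "w = (\<lambda>x. u x - v x)"
  have w: "w \<in> smooth_circle L"
    unfolding w_def by (intro smooth_circle_intros uv)
  have dw: "deriv w x = deriv u x - deriv v x" for x
    unfolding w_def using uv
    by (intro DERIV_imp_deriv DERIV_diff smooth_circle_has_real_derivative)
  let ?e = "\<lambda>x. w x * w x + deriv w x * deriv w x"
  have e: "?e \<in> smooth_circle L"
    by (intro smooth_circle_intros w)
  have "(w, 0) \<in> ext_algebra L"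
    by (simp add: ext_algebra_def w)
  then have "H1_inner L U (w, 0) = H1_inner L V (w, 0)"
    using H1_inertia_eq(2)[OF assms] uv eq by (metis UV)
  then have "integral {0..L} (\<lambda>x. u x * w x + deriv u x * deriv w x) =
      integral {0..L} (\<lambda>x. v x * w x + deriv v x * deriv w x)"
    by (simp add: UV H1_inner_def)
  moreover have "?e = (\<lambda>x. (u x * w x + deriv u x * deriv w x) - (v x * w x + deriv v x * deriv w x))"
    unfolding dw unfolding w_def by (auto simp: algebra_simps)
  ultimately have int0: "integral {0..L} ?e = 0"
    using integral_diff[of "\<lambda>x. u x * w x + deriv u x * deriv w x" "{0..L}"
        "\<lambda>x. v x * w x + deriv v x * deriv w x"]
    by (simp add: smooth_circle_integrable smooth_circle_intros uv w)
  have "w x = 0" for x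
  proof -
    have "?e x = 0"
      by (rule smooth_circle_integral_eq_0D[OF assms e _ int0]) simp
    then show ?thesis
      by (simp add: sum_squares_eq_zero_iff)
  qed
  then have "u = v"
    by (simp add: w_def fun_eq_iff)
  moreover have "a = b"
    using eq uv by (simp add: UV H1_inertia_eq(1)[OF assms])
  ultimately show "U = V"
    by (simp add: UV)
qed

text \<open>The real component is 0 because the bracket ignores the real component of its argument:
  the extension is central.\<close>

lemma ext_coadjoint_eq:
  assumes "L > 0" "v \<in> smooth_circle L" "m \<in> smooth_circle L"
  shows "ext_coadjoint L (v, a) (m, \<kappa>) =
    (\<lambda>x. 2 * m x * deriv v x + deriv m x * v x + \<kappa> * deriv v x, 0)" (is "_ = ?N")
proof -
  note [simp] = assms(2,3)
  have N: "?N \<in> ext_dual L"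
    by (simp add: ext_dual_def smooth_circle_intros)
  have P: "ext_pairing L ?N W = ext_pairing L (m, \<kappa>) (ext_bracket L (v, a) W)"
    if W: "W \<in> ext_algebra L" for W
  proof -
    obtain w b where Ww: "W = (w, b)" and [simp]: "w \<in> smooth_circle L"
      using W by (auto simp: ext_algebra_def)
    \<comment> \<open>The terms with \<open>\<kappa>\<close> cancel, and the remaining difference is
      the derivative of \<open>m v w\<close>.\<close>
    have "integral {0..L} (\<lambda>x. (2 * m x * deriv v x + deriv m x * v x + \<kappa> * deriv v x) * w x) =
        integral {0..L} (\<lambda>x. m x * (deriv v x * w x - v x * deriv w x) + \<kappa> * (deriv v x * w x))"
      by (rule smooth_circle_integral_eqI[OF assms(1), of "\<lambda>x. m x * v x * w x"])
        (auto intro!: smooth_circle_intros derivative_eq_intros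
          smooth_circle_has_real_derivative[of _ L] simp: algebra_simps)
    also have "\<dots> = integral {0..L} (\<lambda>x. m x * (deriv v x * w x - v x * deriv w x)) +
        \<kappa> * integral {0..L} (\<lambda>x. deriv v x * w x)"
      by (subst integral_add) (auto intro!: smooth_circle_integrable smooth_circle_intros)
    finally show ?thesis
      by (simp add: Ww ext_pairing_def ext_bracket_def vf_bracket_def cocycle_def)
  qed
  show ?thesis
    unfolding ext_coadjoint_def coadjoint_op_def
  proof (rule the_equality)
    show "N' = ?N"
      if "N' \<in> ext_dual L \<and> (\<forall>W\<in>ext_algebra L.
        ext_pairing L N' W = ext_pairing L (m, \<kappa>) (ext_bracket L (v, a) W))" for N'
      by (rule ext_pairing_nondegenerate[OF assms(1)]) (use that N P in auto)
  qed (use N P in blast)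
qed

section \<open>Triviality of the cocycle\<close>

lemma trivial_cocycle_cocycle:
  assumes "L > 0"
  shows "trivial_cocycle L (cocycle L)"
proof -
  define f where "f w = integral {0..L} w / 2" for w :: "real \<Rightarrow> real"
  have "f (\<lambda>x. r * u x + s * v x) = r * f u + s * f v"
    if "u \<in> smooth_circle L" "v \<in> smooth_circle L" for u v r s
    unfolding f_def
    by (subst integral_add)
      (auto intro!: smooth_circle_integrable smooth_circle_intros that simp: field_simps)
  moreover have "cocycle L u v = f (vf_bracket u v)"
    if uv: "u \<in> smooth_circle L" "v \<in> smooth_circle L" for u v
  proof -
    \<comment> \<open>The difference is the derivative of \<open>u v\<close>, so the bracket
      integrates to twice the cocycle; hence the factor 1/2 in \<open>f\<close>.\<close>
    have "integral {0..L} (\<lambda>x. 2 * (deriv u x * v x)) = integral {0..L} (vf_bracket u v)"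
      unfolding vf_bracket_def
      by (rule smooth_circle_integral_eqI[OF assms, of "\<lambda>x. u x * v x"])
        (auto intro!: smooth_circle_intros uv derivative_eq_intros
          smooth_circle_has_real_derivative[of _ L] simp: algebra_simps)
    then show ?thesis
      by (simp add: cocycle_def f_def)
  qed
  ultimately show ?thesis
    unfolding trivial_cocycle_def by blast
qed

section \<open>The Euler-Arnold equation\<close>

text \<open>Stated instant by instant, with the singleton \<open>{t}\<close> in
  \<open>camassa_holm\<close>, because \<open>a\<close> may still vary here; that it is constant is
  concluded only afterwards, on an interval.\<close>

lemma euler_arnold_iff:
  assumes "L > 0" "open J" "smooth_on (J \<times> UNIV) (\<lambda>(t, x). u t x)"
    and per: "\<And>t x. t \<in> J \<Longrightarrow> u t (x + L) = u t x"
  shows "euler_arnold L J (\<lambda>t. H1_inertia L (u t, a t)) \<longleftrightarrow>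
    (\<forall>t\<in>J. camassa_holm (a t) {t} u \<and> (a has_real_derivative 0) (at t))"
  unfolding euler_arnold_def
proof (rule ball_cong[OF refl])
  fix t
  assume t: "t \<in> J"
  note sx = smooth_on_dx[OF assms(2,3)]
  note sxx = smooth_on_dx[OF assms(2) sx]
  have circ: "u s \<in> smooth_circle L" if "s \<in> J" for s
    using smooth_on_slice[OF assms(2,3) that] per[OF that] by (simp add: smooth_circle_def)
  define m where "m = (\<lambda>x. u t x - dx (dx u) t x)"
  have dxu: "dx w s = deriv (w s)" for w s
    by (simp add: dx_def)
  have M: "H1_inertia L (u s, a s) = (\<lambda>x. u s x - dx (dx u) s x, a s)" if "s \<in> J" for s
    using H1_inertia_eq(1)[OF assms(1) circ[OF that]] by (simp add: dxu)
  have m: "m \<in> smooth_circle L"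
    unfolding m_def dxu by (intro smooth_circle_intros circ t)
  have dm: "deriv m x = dx u t x - dx (dx (dx u)) t x" for x
    unfolding m_def
    by (intro DERIV_imp_deriv DERIV_diff has_real_derivative_dx[OF assms(3) t]
        has_real_derivative_dx[OF sxx t])
  have inv: "inv_into (ext_algebra L) (H1_inertia L) (H1_inertia L (u t, a t)) = (u t, a t)"
    using circ[OF t] by (intro inv_into_f_f inj_on_H1_inertia assms) (simp add: ext_algebra_def)
  have R: "ext_coadjoint L (inv_into (ext_algebra L) (H1_inertia L) (H1_inertia L (u t, a t)))
      (H1_inertia L (u t, a t)) =
      (\<lambda>x. 2 * m x * dx u t x + deriv m x * u t x + a t * dx u t x, 0)"
    unfolding inv using ext_coadjoint_eq[OF assms(1) circ[OF t] m] M[OF t] by (simp add: m_def dxu)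
  \<comment> \<open>Two exchanges: first \<open>dt\<close> with the outer \<open>dx\<close>, applied
    to \<open>dx u\<close>, then with the inner one.\<close>
  have "dt (dx (dx u)) t x = dx (dx (dt u)) t x" for x
  proof -
    have "dt (dx u) t = dx (dt u) t"
      by (intro ext dt_dx_commute[OF assms(2,3) t])
    then show ?thesis
      using dt_dx_commute[OF assms(2) sx t, of x]
      by (simp add: dxu[of "dt (dx u)"] dxu[of "dx (dt u)"])
  qed
  then have D: "((\<lambda>s. u s x - dx (dx u) s x) has_real_derivative
      dt u t x - dx (dx (dt u)) t x) (at t)" for x
    using DERIV_diff[OF has_real_derivative_dt[OF assms(3) t, of x]
        has_real_derivative_dt[OF sxx t, of x]] by simp
  \<comment> \<open>The formula for the momentum is known only at times in \<open>J\<close>;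
    openness of \<open>J\<close> makes that enough for the derivative at \<open>t\<close>.\<close>
  have D': "((\<lambda>s. fst (H1_inertia L (u s, a s)) x) has_real_derivative
      dt u t x - dx (dx (dt u)) t x) (at t)" for x
    by (rule has_field_derivative_transform_within_open[OF D assms(2) t]) (simp add: M)
  have fst_iff: "((\<lambda>s. fst (H1_inertia L (u s, a s)) x) has_real_derivative r) (at t) \<longleftrightarrow>
      dt u t x - dx (dx (dt u)) t x = r" for x r
    using D'[of x] DERIV_unique by blast
  have snd_iff: "((\<lambda>s. snd (H1_inertia L (u s, a s))) has_real_derivative r) (at t) \<longleftrightarrow>
      (a has_real_derivative r) (at t)" for r
    by (rule DERIV_cong_ev)
      (use eventually_nhds_in_open[OF assms(2) t] in \<open>auto elim!: eventually_mono simp: M\<close>)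
  \<comment> \<open>With \<open>m = u - u\<^sub>x\<^sub>x\<close>, the sum
    \<open>2 m u\<^sub>x + m\<^sub>x u\<close> expands to \<open>3 u u\<^sub>x - 2 u\<^sub>x
    u\<^sub>x\<^sub>x - u u\<^sub>x\<^sub>x\<^sub>x\<close>.\<close>
  have "dt u t x - dx (dx (dt u)) t x =
        - (2 * m x * dx u t x + deriv m x * u t x + a t * dx u t x) \<longleftrightarrow>
      dt u t x + a t * dx u t x - dx (dx (dt u)) t x + 3 * u t x * dx u t x
        - 2 * dx u t x * dx (dx u) t x - u t x * dx (dx (dx u)) t x = 0" for x
    unfolding dm by (simp add: m_def algebra_simps)
  then show "(let R = ext_coadjoint L (inv_into (ext_algebra L) (H1_inertia L)
          (H1_inertia L (u t, a t))) (H1_inertia L (u t, a t)) in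
        (\<forall>x. ((\<lambda>s. fst (H1_inertia L (u s, a s)) x) has_real_derivative - fst R x) (at t)) \<and>
        ((\<lambda>s. snd (H1_inertia L (u s, a s))) has_real_derivative - snd R) (at t)) \<longleftrightarrow>
      camassa_holm (a t) {t} u \<and> (a has_real_derivative 0) (at t)"
    unfolding R Let_def fst_iff snd_iff by (simp add: camassa_holm_def)
qed

text \<open>The two equivalences cover both roles of \<open>\<kappa>\<close>: the conserved real
  momentum of a curve whose \<open>a\<close> is not assumed constant, and an arbitrary prescribed
  number.\<close>

theorem theorem4p13:
  fixes L :: real
  assumes "L > 0"
  shows "trivial_cocycle L (cocycle L) \<and>
    (\<forall>(J :: real set) (u :: real \<Rightarrow> real \<Rightarrow> real) (a :: real \<Rightarrow> real).
       open J \<and> is_interval J \<and>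
       smooth_on (J \<times> UNIV) (\<lambda>(t, x). u t x) \<and> (\<forall>t\<in>J. \<forall>x. u t (x + L) = u t x) \<and>
       smooth_on J a \<longrightarrow>
       (euler_arnold L J (\<lambda>t. H1_inertia L (u t, a t)) \<longleftrightarrow>
         (\<exists>\<kappa>. (\<forall>t\<in>J. snd (H1_inertia L (u t, a t)) = \<kappa>) \<and> camassa_holm \<kappa> J u)) \<and>
       (\<forall>\<kappa>. euler_arnold L J (\<lambda>t. H1_inertia L (u t, \<kappa>)) \<longleftrightarrow> camassa_holm \<kappa> J u))"
proof (intro conjI allI impI)
  show "trivial_cocycle L (cocycle L)"
    by (rule trivial_cocycle_cocycle[OF assms])
next
  fix J :: "real set" and u :: "real \<Rightarrow> real \<Rightarrow> real" and a :: "real \<Rightarrow> real"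
  assume H: "open J \<and> is_interval J \<and>
       smooth_on (J \<times> UNIV) (\<lambda>(t, x). u t x) \<and> (\<forall>t\<in>J. \<forall>x. u t (x + L) = u t x) \<and>
       smooth_on J a"
  then have ea: "euler_arnold L J (\<lambda>t. H1_inertia L (u t, b t)) \<longleftrightarrow>
      (\<forall>t\<in>J. camassa_holm (b t) {t} u \<and> (b has_real_derivative 0) (at t))" for b
    using euler_arnold_iff[OF assms, of J u b] by blast
  have ch: "camassa_holm \<kappa> J u \<longleftrightarrow> (\<forall>t\<in>J. camassa_holm \<kappa> {t} u)" for \<kappa>
    by (simp add: camassa_holm_def)
  have snd_eq: "snd (H1_inertia L (u t, a t)) = a t" if "t \<in> J" for t
  proof -
    have "u t \<in> smooth_circle L"
      using H that smooth_on_slice[of J u t] by (simp add: smooth_circle_def)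
    then show ?thesis
      by (simp add: H1_inertia_eq(1)[OF assms])
  qed
  \<comment> \<open>Forwards, a zero derivative on a connected set forces constancy; backwards,
    \<open>a\<close> agrees with a constant on the open set \<open>J\<close>.\<close>
  have const: "(\<forall>t\<in>J. (a has_real_derivative 0) (at t)) \<longleftrightarrow> (\<exists>\<kappa>. \<forall>t\<in>J. a t = \<kappa>)"
  proof
    assume "\<forall>t\<in>J. (a has_real_derivative 0) (at t)"
    then have "a constant_on J"
      using H is_interval_connected by (intro has_field_derivative_0_imp_constant_on) blast+
    then show "\<exists>\<kappa>. \<forall>t\<in>J. a t = \<kappa>"
      by (simp add: constant_on_def)
  next
    assume "\<exists>\<kappa>. \<forall>t\<in>J. a t = \<kappa>"
    then obtain \<kappa> where "\<And>t. t \<in> J \<Longrightarrow> \<kappa> = a t"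
      by metis
    then show "\<forall>t\<in>J. (a has_real_derivative 0) (at t)"
      using has_field_derivative_transform_within_open[OF DERIV_const, of J _ \<kappa> a] H by blast
  qed
  show "euler_arnold L J (\<lambda>t. H1_inertia L (u t, a t)) \<longleftrightarrow>
      (\<exists>\<kappa>. (\<forall>t\<in>J. snd (H1_inertia L (u t, a t)) = \<kappa>) \<and> camassa_holm \<kappa> J u)"
    unfolding ea ch using const snd_eq by (metis (no_types, lifting))
  show "euler_arnold L J (\<lambda>t. H1_inertia L (u t, \<kappa>)) \<longleftrightarrow> camassa_holm \<kappa> J u" for \<kappa>
    unfolding ea[of "\<lambda>_. \<kappa>"] ch by simp
qed

end
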